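(* Let $\mathbb{F}$ be a field, $n\ge2$, $1\le m\le n$, and let $\nu$ be a partition of $n-m$. Then a partition $\mu$ of $n$ is $(\nu,m)$-eligible if and only if $\mu'/\nu'$ is a horizontal strip of size $m$.
   Context: $J_\nu$ is the block diagonal matrix of nilpotent upper triangular Jordan blocks of sizes $\nu_1,\nu_2,\dots$; $\mathcal{C}_\mu$ is the $\mathrm{GL}_n(\mathbb{F})$-conjugacy class of $J_\mu$. A partition $\mu$ of $n$ is $(\nu,m)$-eligible if there exists an $(n-m)\times m$ matrix $Z$ over $\mathbb{F}$ such that the $n\times n$ block matrix $\begin{pmatrix}J_\nu&Z\\0&0_{m\times m}\end{pmatrix}$ lies in $\mathcal{C}_\mu$. $\mu'$ denotes the conjugate partition. For partitions $\rho\subseteq\eta$, $\eta/\rho$ is a horizontal strip of size $m$ if $|\eta|-|\rho|=m$ and no two boxes of the skew diagram $\eta/\rho$ lie in the same column. *)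

theory Defs
  imports "Jordan_Normal_Form.Jordan_Normal_Form"
begin

(* Partitions are weakly decreasing lists of positive parts, so that each partition has
   exactly one representation; the empty list is the partition of 0. *)
definition partition_of :: "nat \<Rightarrow> nat list \<Rightarrow> bool" where
  "partition_of n xs \<longleftrightarrow> sorted_wrt (\<ge>) xs \<and> 0 \<notin> set xs \<and> sum_list xs = n"

(* Boxes (row, column), both counted from 0, in English notation. *)
definition diagram :: "nat list \<Rightarrow> (nat \<times> nat) set" where
  "diagram xs = {(i, j). i < length xs \<and> j < xs ! i}"

definition conjugate_partition :: "nat list \<Rightarrow> nat list" where
  "conjugate_partition xs =
     (case xs of [] \<Rightarrow> [] | k # _ \<Rightarrow> map (\<lambda>j. card {i. i < length xs \<and> j < xs ! i}) [0..<k])"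

lemma diagram_conjugate_partition:
  assumes "partition_of n xs"
  shows "diagram (conjugate_partition xs) = (diagram xs)\<inverse>"
proof (cases xs)
  case Nil
  then show ?thesis by (simp add: diagram_def conjugate_partition_def)
next
  case (Cons k ks)
  have desc: "xs ! i' \<le> xs ! i" if "i \<le> i'" "i' < length xs" for i i'
    using that assms sorted_wrt_nth_less[of "(\<ge>)" xs i i']
    by (cases "i = i'") (auto simp: partition_of_def)
  have "(i < k \<and> j < card {l. l < length xs \<and> i < xs ! l}) \<longleftrightarrow> (j < length xs \<and> i < xs ! j)"
    for i j
  proof
    assume *: "i < k \<and> j < card {l. l < length xs \<and> i < xs ! l}"
    show "j < length xs \<and> i < xs ! j"
    proof (rule ccontr)
      assume neg: "\<not> (j < length xs \<and> i < xs ! j)"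
      have "{l. l < length xs \<and> i < xs ! l} \<subseteq> {..<j}"
      proof
        fix l assume l: "l \<in> {l. l < length xs \<and> i < xs ! l}"
        show "l \<in> {..<j}"
        proof (rule ccontr)
          assume "l \<notin> {..<j}"
          with l neg desc[of j l] show False by auto
        qed
      qed
      then have "card {l. l < length xs \<and> i < xs ! l} \<le> j"
        using card_mono[of "{..<j}"] by fastforce
      with * show False by simp
    qed
  next
    assume *: "j < length xs \<and> i < xs ! j"
    have "{..j} \<subseteq> {l. l < length xs \<and> i < xs ! l}"
      using * desc by (fastforce intro: less_le_trans)
    then have "Suc j \<le> card {l. l < length xs \<and> i < xs ! l}"
      using card_mono[of "{l. l < length xs \<and> i < xs ! l}" "{..j}"] by simp
    moreover have "i < k" using * desc[of 0 j] Cons by simp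
    ultimately show "i < k \<and> j < card {l. l < length xs \<and> i < xs ! l}" by simp
  qed
  note col = this
  have "conjugate_partition xs = map (\<lambda>j. card {i. i < length xs \<and> j < xs ! i}) [0..<k]"
    by (simp add: conjugate_partition_def Cons)
  then have "(i, j) \<in> diagram (conjugate_partition xs) \<longleftrightarrow>
      i < k \<and> j < card {l. l < length xs \<and> i < xs ! l}" for i j
    by (simp add: diagram_def cong: conj_cong)
  then show ?thesis
    unfolding col by (auto simp: diagram_def)
qed

(* The last conjunct says that distinct boxes of the skew diagram lie in distinct columns. *)
definition horizontal_strip :: "nat \<Rightarrow> nat list \<Rightarrow> nat list \<Rightarrow> bool" where
  "horizontal_strip m \<eta> \<rho> \<longleftrightarrow>
     diagram \<rho> \<subseteq> diagram \<eta> \<and> sum_list \<eta> = sum_list \<rho> + m \<and>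
     inj_on snd (diagram \<eta> - diagram \<rho>)"

definition nilpotent_jordan :: "nat list \<Rightarrow> 'a::field mat" where
  "nilpotent_jordan \<nu> = jordan_matrix (map (\<lambda>k. (k, 0)) \<nu>)"

definition conj_class :: "nat list \<Rightarrow> 'a::field mat set" where
  "conj_class \<mu> = {A. similar_mat A (nilpotent_jordan \<mu>)}"

(* The type argument is the ground field, which does not occur in the other arguments. *)
definition eligible ::
  "'a::field itself \<Rightarrow> nat \<Rightarrow> nat list \<Rightarrow> nat \<Rightarrow> nat list \<Rightarrow> bool" where
  "eligible _ n \<nu> m \<mu> \<longleftrightarrow>
     (\<exists>Z \<in> carrier_mat (n - m) m.
        four_block_mat (nilpotent_jordan \<nu>) Z (0\<^sub>m m (n - m)) (0\<^sub>m m m)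
          \<in> (conj_class \<mu> :: 'a mat set))"

end

(* Write A = [[J, Z], [0, 0]] with J = J_nu, and let W be the span of the first n - m basis vectors,
   so that A V \<subseteq> W and J is the restriction of A to W. By rank-nullity the number of parts of mu
   larger than k is dim (ker A \<inter> A^k V), and the number of parts of nu larger than k is
   dim (ker A \<inter> A^k W). From A^(k+1) V \<subseteq> A^k W \<subseteq> A^k V one reads off that nu is contained in mu and that
   every row of mu/nu has at most one box, which is the horizontal strip condition for the conjugates.
   Conversely, a row of length k is lengthened by one by adding to Z a column whose image is the last
   basis vector of the corresponding Jordan block. *)

theory Submission
  imports Defs "Jordan_Normal_Form.DL_Rank" "Jordan_Normal_Form.Jordan_Normal_Form_Uniqueness"
begin

section \<open>Matrices acting on subspaces: rank-nullity and comparison of dimensions\<close>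

lemma linear_map_mult_mat_vec:
  fixes E :: "'a::field mat"
  assumes E: "E \<in> carrier_mat b a"
    and U: "subspace class_ring U (module_vec TYPE('a) a)"
    and U': "subspace class_ring U' (module_vec TYPE('a) b)"
    and im: "\<And>u. u \<in> U \<Longrightarrow> E *\<^sub>v u \<in> U'"
  shows "linear_map class_ring ((module_vec TYPE('a) a)\<lparr>carrier := U\<rparr>)
    ((module_vec TYPE('a) b)\<lparr>carrier := U'\<rparr>) (\<lambda>v. E *\<^sub>v v)"
proof -
  interpret A: vec_space "TYPE('a)" a .
  interpret B: vec_space "TYPE('a)" b .
  have sub: "U \<subseteq> carrier_vec a"
    using U unfolding subspace_def submodule_def by (auto simp: module_vec_simps)
  show ?thesis
    using A.subspace_is_vs[OF U] B.subspace_is_vs[OF U'] sub im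
    by (auto simp: linear_map_def mod_hom_def mod_hom_axioms_def module_hom_def
        vectorspace_def module_vec_simps mult_add_distrib_mat_vec[OF E] mult_mat_vec[OF E] subset_eq)
qed

lemma subspace_mat_kernel:
  fixes A :: "'a::field mat"
  assumes A: "A \<in> carrier_mat nr nc"
  shows "subspace class_ring (mat_kernel A) (module_vec TYPE('a) nc)"
proof -
  interpret kernel nr nc A using A by unfold_locales
  have "submodule class_ring (mat_kernel A) (module_vec TYPE('a) nc)"
    by (unfold_locales)
      (insert A mult_add_distrib_mat_vec[OF A] mult_mat_vec[OF A] mat_kernel[OF A],
        auto simp: class_ring_simps module_vec_simps)
  then show ?thesis using NC.vectorspace_axioms by (simp add: subspace_def)
qed

lemma kernel_fin_dim:
  fixes A :: "'a::field mat"
  assumes A: "A \<in> carrier_mat nr nc"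
  shows "vectorspace.fin_dim class_ring ((module_vec TYPE('a) nc)\<lparr>carrier := mat_kernel A\<rparr>)"
proof -
  interpret kernel nr nc A using A by unfold_locales
  from kernel_basis_exists[OF A] obtain B where "finite B" "basis B" by auto
  then show ?thesis unfolding Ker.fin_dim_def Ker.basis_def by auto
qed

lemma subspace_dim_mono:
  fixes U U' :: "'a::field vec set"
  assumes U: "subspace class_ring U (module_vec TYPE('a) n)"
    and U': "subspace class_ring U' (module_vec TYPE('a) n)"
    and finU: "vectorspace.fin_dim class_ring ((module_vec TYPE('a) n)\<lparr>carrier := U\<rparr>)"
    and finU': "vectorspace.fin_dim class_ring ((module_vec TYPE('a) n)\<lparr>carrier := U'\<rparr>)"
    and sub: "U \<subseteq> U'"
  shows "vectorspace.dim class_ring ((module_vec TYPE('a) n)\<lparr>carrier := U\<rparr>)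
    \<le> vectorspace.dim class_ring ((module_vec TYPE('a) n)\<lparr>carrier := U'\<rparr>)"
proof -
  interpret vec_space "TYPE('a)" n .
  interpret W: vectorspace class_ring "vs U'" using U' by (rule subspace_is_vs)
  show ?thesis
    using W.subspace_dim[OF nested_subspaces[OF U' U sub] finU'] finU by simp
qed

text \<open>Rank-nullity for the restriction of v \<mapsto> E v to U, whose kernel is U \<inter> ker
  E. The map is read twice: into the whole space, which makes its image a subspace, and then onto
  that image.\<close>

lemma rank_nullity_mult_mat_vec:
  fixes E :: "'a::field mat"
  assumes E: "E \<in> carrier_mat b a"
    and U: "subspace class_ring U (module_vec TYPE('a) a)"
    and finU: "vectorspace.fin_dim class_ring ((module_vec TYPE('a) a)\<lparr>carrier := U\<rparr>)"
  shows "subspace class_ring ((\<lambda>v. E *\<^sub>v v) ` U) (module_vec TYPE('a) b)"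
      (is "subspace _ ?im _")
    and "vectorspace.fin_dim class_ring ((module_vec TYPE('a) b)\<lparr>carrier := (\<lambda>v. E *\<^sub>v v) ` U\<rparr>)"
    and "vectorspace.dim class_ring ((module_vec TYPE('a) b)\<lparr>carrier := (\<lambda>v. E *\<^sub>v v) ` U\<rparr>)
      + vectorspace.dim class_ring ((module_vec TYPE('a) a)\<lparr>carrier := U \<inter> mat_kernel E\<rparr>)
      = vectorspace.dim class_ring ((module_vec TYPE('a) a)\<lparr>carrier := U\<rparr>)"
proof -
  interpret B: vec_space "TYPE('a)" b .
  have sub: "U \<subseteq> carrier_vec a"
    using U unfolding subspace_def submodule_def by (auto simp: module_vec_simps)
  have full: "subspace class_ring (carrier_vec b) (module_vec TYPE('a) b)"
    by (unfold_locales) (auto simp: module_vec_simps)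
  have maps: "E *\<^sub>v u \<in> carrier_vec b" if "u \<in> U" for u
    using E sub that by (auto intro: mult_mat_vec_carrier)
  interpret L: linear_map class_ring "(module_vec TYPE('a) a)\<lparr>carrier := U\<rparr>"
    "(module_vec TYPE('a) b)\<lparr>carrier := carrier_vec b\<rparr>" "\<lambda>v. E *\<^sub>v v"
    by (rule linear_map_mult_mat_vec[OF E U full maps])
  have im: "L.im = ?im" by (simp add: L.im_def)
  have B: "Module.module class_ring (module_vec TYPE('a) b)" by unfold_locales
  show im_sub: "subspace class_ring ?im (module_vec TYPE('a) b)"
    using L.imT_is_subspace B.vectorspace_axioms B
    unfolding im subspace_def submodule_def by (simp add: module_vec_simps)
  interpret I: linear_map class_ring "(module_vec TYPE('a) a)\<lparr>carrier := U\<rparr>"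
    "(module_vec TYPE('a) b)\<lparr>carrier := ?im\<rparr>" "\<lambda>v. E *\<^sub>v v"
    by (rule linear_map_mult_mat_vec[OF E U im_sub]) auto
  show "vectorspace.fin_dim class_ring ((module_vec TYPE('a) b)\<lparr>carrier := ?im\<rparr>)"
    using I.rank_nullity_main(2)[OF finU] by simp
  have "I.ker = U \<inter> mat_kernel E"
    using sub unfolding I.ker_def mat_kernel[OF E] by (auto simp: module_vec_simps)
  with I.rank_nullity[OF finU]
  show "vectorspace.dim class_ring ((module_vec TYPE('a) b)\<lparr>carrier := ?im\<rparr>)
      + vectorspace.dim class_ring ((module_vec TYPE('a) a)\<lparr>carrier := U \<inter> mat_kernel E\<rparr>)
      = vectorspace.dim class_ring ((module_vec TYPE('a) a)\<lparr>carrier := U\<rparr>)"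
    by (simp add: I.im_def)
qed

text \<open>By \<open>inj\<close> the restriction of E to U has kernel zero, so rank-nullity equates
  dim U with the dimension of its image, a subspace of U'. Injectivity is asked on U alone, so E
  itself may have a kernel, as a truncation of vectors does.\<close>

lemma dim_le_of_inj_mat:
  fixes E :: "'a::field mat"
  assumes E: "E \<in> carrier_mat b a"
    and U: "subspace class_ring U (module_vec TYPE('a) a)"
    and U': "subspace class_ring U' (module_vec TYPE('a) b)"
    and finU: "vectorspace.fin_dim class_ring ((module_vec TYPE('a) a)\<lparr>carrier := U\<rparr>)"
    and finU': "vectorspace.fin_dim class_ring ((module_vec TYPE('a) b)\<lparr>carrier := U'\<rparr>)"
    and im: "\<And>u. u \<in> U \<Longrightarrow> E *\<^sub>v u \<in> U'"
    and inj: "\<And>u. u \<in> U \<Longrightarrow> E *\<^sub>v u = 0\<^sub>v b \<Longrightarrow> u = 0\<^sub>v a"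
  shows "vectorspace.dim class_ring ((module_vec TYPE('a) a)\<lparr>carrier := U\<rparr>)
    \<le> vectorspace.dim class_ring ((module_vec TYPE('a) b)\<lparr>carrier := U'\<rparr>)"
proof -
  interpret vec_space "TYPE('a)" a .
  have "0\<^sub>v a \<in> U"
    using submodule.zero_closed[of class_ring U "module_vec TYPE('a) a"] U by (simp add: subspace_def module_vec_simps)
  then have "U \<inter> mat_kernel E = {0\<^sub>v a}"
    using inj E by (auto simp: mat_kernel[OF E])
  moreover have "vectorspace.dim class_ring (vs {0\<^sub>v a}) = 0"
    using dim_zero_vs by (simp add: span_empty module_vec_simps)
  moreover note R = rank_nullity_mult_mat_vec[OF E U finU]
  ultimately have "vectorspace.dim class_ring (vs U) = vectorspace.dim class_ring
      ((module_vec TYPE('a) b)\<lparr>carrier := (\<lambda>v. E *\<^sub>v v) ` U\<rparr>)"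
    by simp
  also have "\<dots> \<le> vectorspace.dim class_ring ((module_vec TYPE('a) b)\<lparr>carrier := U'\<rparr>)"
    using im by (intro subspace_dim_mono[OF R(1) U' R(2) finU']) auto
  finally show ?thesis .
qed

section \<open>Kernel dimensions of products and powers\<close>

text \<open>Rank-nullity for Y restricted to ker(X Y); the kernel of this restriction is all of ker
  Y, because ker Y \<subseteq> ker(X Y).\<close>

lemma kernel_dim_mult:
  fixes X Y :: "'a::field mat"
  assumes X: "X \<in> carrier_mat a b" and Y: "Y \<in> carrier_mat b c"
  shows "kernel_dim (X * Y) = kernel_dim Y + vectorspace.dim class_ring
      ((module_vec TYPE('a) b)\<lparr>carrier := (\<lambda>v. Y *\<^sub>v v) ` mat_kernel (X * Y)\<rparr>)"
proof -
  have XY: "X * Y \<in> carrier_mat a c" using X Y by simp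
  have "mat_kernel (X * Y) \<inter> mat_kernel Y = mat_kernel Y"
    using mat_kernel_mult_subset[OF Y X] by auto
  then show ?thesis
    using rank_nullity_mult_mat_vec(3)[OF Y subspace_mat_kernel[OF XY] kernel_fin_dim[OF XY]] Y
    by (simp add: kernel_dim_def)
qed

text \<open>The set on the right is im Y \<inter> ker X, parametrised by preimages under Y.\<close>

lemma kernel_image_eq:
  fixes X Y :: "'a::field mat"
  assumes X: "X \<in> carrier_mat a b" and Y: "Y \<in> carrier_mat b c"
  shows "(\<lambda>v. Y *\<^sub>v v) ` mat_kernel (X * Y) = {Y *\<^sub>v v | v. v \<in> carrier_vec c \<and> X *\<^sub>v (Y *\<^sub>v v) = 0\<^sub>v a}"
  using X Y by (auto simp: mat_kernel[OF mult_carrier_mat[OF X Y]] image_def)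

(* By rank-nullity ker(X Y) / ker Y is isomorphic to im Y \<inter> ker X, which E embeds into im Y' \<inter> ker X'. *)
lemma kernel_dim_diff_le:
  fixes X Y X' Y' E :: "'a::field mat"
  assumes X: "X \<in> carrier_mat a b" and Y: "Y \<in> carrier_mat b c"
    and X': "X' \<in> carrier_mat a' b'" and Y': "Y' \<in> carrier_mat b' c'"
    and E: "E \<in> carrier_mat b' b"
    and im: "\<And>v. v \<in> carrier_vec c \<Longrightarrow> X *\<^sub>v (Y *\<^sub>v v) = 0\<^sub>v a \<Longrightarrow>
      \<exists>w \<in> carrier_vec c'. E *\<^sub>v (Y *\<^sub>v v) = Y' *\<^sub>v w \<and> X' *\<^sub>v (Y' *\<^sub>v w) = 0\<^sub>v a'"
    and inj: "\<And>v. v \<in> carrier_vec c \<Longrightarrow> E *\<^sub>v (Y *\<^sub>v v) = 0\<^sub>v b' \<Longrightarrow> Y *\<^sub>v v = 0\<^sub>v b"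
  shows "kernel_dim (X * Y) + kernel_dim Y' \<le> kernel_dim (X' * Y') + kernel_dim Y"
proof -
  have XY: "X * Y \<in> carrier_mat a c" and XY': "X' * Y' \<in> carrier_mat a' c'"
    using X Y X' Y' by auto
  note R = rank_nullity_mult_mat_vec[OF Y subspace_mat_kernel[OF XY] kernel_fin_dim[OF XY]]
  note R' = rank_nullity_mult_mat_vec[OF Y' subspace_mat_kernel[OF XY'] kernel_fin_dim[OF XY']]
  have "E *\<^sub>v u \<in> (\<lambda>v. Y' *\<^sub>v v) ` mat_kernel (X' * Y')" if "u \<in> (\<lambda>v. Y *\<^sub>v v) ` mat_kernel (X * Y)" for u
    using im that unfolding kernel_image_eq[OF X Y] kernel_image_eq[OF X' Y'] by blast
  moreover have "u = 0\<^sub>v b" if "u \<in> (\<lambda>v. Y *\<^sub>v v) ` mat_kernel (X * Y)" "E *\<^sub>v u = 0\<^sub>v b'" for u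
    using inj that unfolding kernel_image_eq[OF X Y] by blast
  ultimately show ?thesis
    using dim_le_of_inj_mat[OF E R(1) R'(1) R(2) R'(2)]
    unfolding kernel_dim_mult[OF X Y] kernel_dim_mult[OF X' Y'] by simp
qed

lemma mat_pow_Suc_left:
  assumes A: "A \<in> carrier_mat n n"
  shows "A ^\<^sub>m Suc k = A * A ^\<^sub>m k"
proof (induct k)
  case (Suc k)
  have "A ^\<^sub>m Suc (Suc k) = A * A ^\<^sub>m k * A" using Suc by simp
  also have "\<dots> = A * A ^\<^sub>m Suc k" using assoc_mult_mat[OF A pow_carrier_mat[OF A] A] by simp
  finally show ?case .
qed (use A in simp)

text \<open>With X Y = J J^k the increment of the kernel dimension from J^k to J^(k+1) is dim(ker J
  \<inter> im J^k), and likewise for A. The first inequality then follows from A^k W \<subseteq> A^k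
  V, the second from A^(k+1) V \<subseteq> A^k W. Both are stated additively to avoid subtraction on
  naturals.\<close>

lemma kernel_dim_extension:
  fixes J Z :: "'a::field mat"
  assumes J: "J \<in> carrier_mat p p" and Z: "Z \<in> carrier_mat p m"
  defines "A \<equiv> four_block_mat J Z (0\<^sub>m m p) (0\<^sub>m m m)"
  shows "kernel_dim (J ^\<^sub>m Suc k) + kernel_dim (A ^\<^sub>m k)
      \<le> kernel_dim (A ^\<^sub>m Suc k) + kernel_dim (J ^\<^sub>m k)"
    and "kernel_dim (A ^\<^sub>m Suc (Suc k)) + kernel_dim (J ^\<^sub>m k)
      \<le> kernel_dim (J ^\<^sub>m Suc k) + kernel_dim (A ^\<^sub>m Suc k)"
proof -
  define n where "n = p + m"
  \<comment> \<open>E is the inclusion of W into V, P the projection to the first p coordinates, and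
    R consists of the top p rows of A. The identities A = E R and J = R E below encode A V
    \<subseteq> W and that A restricts to J on W.\<close>
  define E where "E = (mat n p (\<lambda>(i, j). if i = j then 1 else 0) :: 'a mat)"
  define P where "P = (mat p n (\<lambda>(i, j). if i = j then 1 else 0) :: 'a mat)"
  define R where "R = mat p n (\<lambda>(i, j). A $$ (i, j))"
  have E: "E \<in> carrier_mat n p" and P: "P \<in> carrier_mat p n" and R: "R \<in> carrier_mat p n"
    by (auto simp: E_def P_def R_def)
  have A: "A \<in> carrier_mat n n" using J Z by (simp add: A_def n_def)
  have delta: "(if b then 1 else 0) * x = (if b then x else 0)"
    "x * (if b then 1 else 0) = (if b then x else 0)" for b and x :: 'a
    by auto
  have PE: "P * E = 1\<^sub>m p"
    by (rule eq_matI) (auto simp: P_def E_def scalar_prod_def n_def delta sum.If_cases cong: if_cong)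
  have ER: "E * R = A"
    using J Z
    by (intro eq_matI) (auto simp: A_def E_def R_def scalar_prod_def n_def delta sum.If_cases cong: if_cong)
  have RE: "R * E = J"
    using J Z
    by (intro eq_matI) (auto simp: A_def E_def R_def scalar_prod_def n_def delta sum.If_cases cong: if_cong)
  have Ak: "A ^\<^sub>m j \<in> carrier_mat n n" and Jk: "J ^\<^sub>m j \<in> carrier_mat p p" for j
    using A J by auto
  have AE: "A * E = E * J"
    using assoc_mult_mat[OF E R E] by (simp add: ER RE)
  have AkE: "A ^\<^sub>m j * E = E * J ^\<^sub>m j" for j
  proof (induct j)
    case 0
    show ?case using A J E by simp
  next
    case (Suc j)
    have "A ^\<^sub>m Suc j * E = A ^\<^sub>m j * E * J"
      using assoc_mult_mat[OF Ak A E, of j] assoc_mult_mat[OF Ak E J, of j] AE by simp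
    also have "\<dots> = E * J ^\<^sub>m Suc j"
      using Suc assoc_mult_mat[OF E Jk J] by simp
    finally show ?case .
  qed
  \<comment> \<open>The factored form of A^(j+1) V \<subseteq> A^j W: every vector of im A^(j+1) is
    the image under E of a vector of im J^j.\<close>
  have AkSuc: "A ^\<^sub>m Suc j = E * (J ^\<^sub>m j * R)" for j
  proof -
    have "A ^\<^sub>m Suc j = A ^\<^sub>m j * (E * R)" by (simp add: ER)
    also have "\<dots> = E * (J ^\<^sub>m j * R)"
      using assoc_mult_mat[OF Ak E R] assoc_mult_mat[OF E Jk R] AkE by simp
    finally show ?thesis .
  qed
  have JR: "J ^\<^sub>m j * R \<in> carrier_mat p n" for j using Jk R by (rule mult_carrier_mat)
  have PAk: "P * A ^\<^sub>m Suc j = J ^\<^sub>m j * R" for j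
    unfolding AkSuc assoc_mult_mat[OF P E JR, symmetric] PE by (rule left_mult_one_mat[OF JR])
  have Suc_eq: "A ^\<^sub>m Suc j = A * A ^\<^sub>m j" "J ^\<^sub>m Suc j = J * J ^\<^sub>m j" for j
    using mat_pow_Suc_left[OF A] mat_pow_Suc_left[OF J] by simp_all
  show "kernel_dim (J ^\<^sub>m Suc k) + kernel_dim (A ^\<^sub>m k)
      \<le> kernel_dim (A ^\<^sub>m Suc k) + kernel_dim (J ^\<^sub>m k)"
    unfolding Suc_eq
  \<comment> \<open>E carries im J^k \<inter> ker J into im A^k \<inter> ker A with E v as the new
    preimage, since E intertwines the powers. It is injective because P is a left inverse.\<close>
  proof (rule kernel_dim_diff_le[OF J Jk A Ak E])
    fix v :: "'a vec" assume v: "v \<in> carrier_vec p"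
    have Jv: "J ^\<^sub>m k *\<^sub>v v \<in> carrier_vec p" using Jk v by (rule mult_mat_vec_carrier)
    {
      assume z: "J *\<^sub>v (J ^\<^sub>m k *\<^sub>v v) = 0\<^sub>v p"
      have eq: "E *\<^sub>v (J ^\<^sub>m k *\<^sub>v v) = A ^\<^sub>m k *\<^sub>v (E *\<^sub>v v)"
        using assoc_mult_mat_vec[OF E Jk v] assoc_mult_mat_vec[OF Ak E v] AkE by simp
      have "A *\<^sub>v (A ^\<^sub>m k *\<^sub>v (E *\<^sub>v v)) = E *\<^sub>v (J *\<^sub>v (J ^\<^sub>m k *\<^sub>v v))"
        using assoc_mult_mat_vec[OF A E Jv] assoc_mult_mat_vec[OF E J Jv] AE eq by simp
      also have "\<dots> = 0\<^sub>v n" unfolding z using E by auto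
      finally show "\<exists>w\<in>carrier_vec n. E *\<^sub>v (J ^\<^sub>m k *\<^sub>v v) = A ^\<^sub>m k *\<^sub>v w
          \<and> A *\<^sub>v (A ^\<^sub>m k *\<^sub>v w) = 0\<^sub>v n"
        using eq mult_mat_vec_carrier[OF E v] by blast
    }
    assume z: "E *\<^sub>v (J ^\<^sub>m k *\<^sub>v v) = 0\<^sub>v n"
    have "J ^\<^sub>m k *\<^sub>v v = P *\<^sub>v (E *\<^sub>v (J ^\<^sub>m k *\<^sub>v v))"
      using assoc_mult_mat_vec[OF P E Jv] PE Jv by simp
    also have "\<dots> = 0\<^sub>v p" unfolding z using P by auto
    finally show "J ^\<^sub>m k *\<^sub>v v = 0\<^sub>v p" .
  qed
  show "kernel_dim (A ^\<^sub>m Suc (Suc k)) + kernel_dim (J ^\<^sub>m k)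
      \<le> kernel_dim (J ^\<^sub>m Suc k) + kernel_dim (A ^\<^sub>m Suc k)"
    unfolding Suc_eq(1)[of "Suc k"] Suc_eq(2)
  \<comment> \<open>P carries im A^(k+1) \<inter> ker A into im J^k \<inter> ker J with R v as the
    new preimage. P kills vectors outside W, but im A^(k+1) lies in im E, where E P is the
    identity.\<close>
  proof (rule kernel_dim_diff_le[OF A Ak J Jk P])
    fix v :: "'a vec" assume v: "v \<in> carrier_vec n"
    have Rv: "R *\<^sub>v v \<in> carrier_vec p" using R v by (rule mult_mat_vec_carrier)
    have eq: "P *\<^sub>v (A ^\<^sub>m Suc j *\<^sub>v v) = J ^\<^sub>m j *\<^sub>v (R *\<^sub>v v)" for j
      using assoc_mult_mat_vec[OF P Ak v, of "Suc j"] assoc_mult_mat_vec[OF Jk R v] PAk by simp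
    {
      assume z: "A *\<^sub>v (A ^\<^sub>m Suc k *\<^sub>v v) = 0\<^sub>v n"
      have "J *\<^sub>v (J ^\<^sub>m k *\<^sub>v (R *\<^sub>v v)) = J ^\<^sub>m Suc k *\<^sub>v (R *\<^sub>v v)"
        using assoc_mult_mat_vec[OF J Jk Rv] by (simp only: Suc_eq(2))
      also have "\<dots> = P *\<^sub>v (A *\<^sub>v (A ^\<^sub>m Suc k *\<^sub>v v))"
        unfolding eq[symmetric] using assoc_mult_mat_vec[OF A Ak v] by (simp only: Suc_eq(1)[of "Suc k"])
      also have "\<dots> = 0\<^sub>v p" unfolding z using P by auto
      finally show "\<exists>w\<in>carrier_vec p. P *\<^sub>v (A ^\<^sub>m Suc k *\<^sub>v v) = J ^\<^sub>m k *\<^sub>v w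
          \<and> J *\<^sub>v (J ^\<^sub>m k *\<^sub>v w) = 0\<^sub>v p"
        using eq Rv by blast
    }
    assume z: "P *\<^sub>v (A ^\<^sub>m Suc k *\<^sub>v v) = 0\<^sub>v p"
    have "A ^\<^sub>m Suc k *\<^sub>v v = E *\<^sub>v (J ^\<^sub>m k *\<^sub>v (R *\<^sub>v v))"
      unfolding AkSuc using assoc_mult_mat_vec[OF E JR v] assoc_mult_mat_vec[OF Jk R v] by simp
    also have "\<dots> = 0\<^sub>v n" unfolding eq[symmetric] z using E by auto
    finally show "A ^\<^sub>m Suc k *\<^sub>v v = 0\<^sub>v n" .
  qed
qed

section \<open>Construction of Z, one row of the partition at a time\<close>

text \<open>Renumbering the basis by \<pi> is conjugation by its permutation matrix P, whose inverse
  Q is the transpose. Injectivity of \<pi> gives P Q = 1, and for square matrices this yields Q P =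
  1 as well.\<close>

lemma similar_mat_permute:
  fixes A B :: "'a::field mat"
  assumes A: "A \<in> carrier_mat n n" and B: "B \<in> carrier_mat n n"
    and inj: "inj_on \<pi> {..<n}" and ran: "\<And>i. i < n \<Longrightarrow> \<pi> i < n"
    and eq: "\<And>i j. i < n \<Longrightarrow> j < n \<Longrightarrow> A $$ (i, j) = B $$ (\<pi> i, \<pi> j)"
  shows "similar_mat A B"
proof -
  define P where "P = (mat n n (\<lambda>(i, j). if \<pi> i = j then 1 else 0) :: 'a mat)"
  define Q where "Q = (mat n n (\<lambda>(i, j). if i = \<pi> j then 1 else 0) :: 'a mat)"
  have P: "P \<in> carrier_mat n n" and Q: "Q \<in> carrier_mat n n" by (auto simp: P_def Q_def)
  have PM: "(P * M) $$ (i, j) = M $$ (\<pi> i, j)" if M: "M \<in> carrier_mat n n" and ij: "i < n" "j < n" for M i j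
  proof -
    have "(P * M) $$ (i, j) = (\<Sum>l = 0..<n. P $$ (i, l) * M $$ (l, j))"
      using P M ij by (simp add: scalar_prod_def)
    also have "\<dots> = (\<Sum>l = 0..<n. if \<pi> i = l then M $$ (l, j) else 0)"
      using ij by (intro sum.cong) (auto simp: P_def)
    also have "\<dots> = M $$ (\<pi> i, j)" using ran[OF ij(1)] by simp
    finally show ?thesis .
  qed
  have MQ: "(M * Q) $$ (i, j) = M $$ (i, \<pi> j)" if M: "M \<in> carrier_mat n n" and ij: "i < n" "j < n" for M i j
  proof -
    have "(M * Q) $$ (i, j) = (\<Sum>l = 0..<n. M $$ (i, l) * Q $$ (l, j))"
      using Q M ij by (simp add: scalar_prod_def)
    also have "\<dots> = (\<Sum>l = 0..<n. if l = \<pi> j then M $$ (i, l) else 0)"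
      using ij by (intro sum.cong) (auto simp: Q_def)
    also have "\<dots> = M $$ (i, \<pi> j)" using ran[OF ij(2)] by simp
    finally show ?thesis .
  qed
  have PQ: "P * Q = 1\<^sub>m n"
  proof (rule eq_matI)
    fix i j assume "i < dim_row (1\<^sub>m n :: 'a mat)" "j < dim_col (1\<^sub>m n :: 'a mat)"
    then show "(P * Q) $$ (i, j) = 1\<^sub>m n $$ (i, j)"
      using PM[OF Q, of i j] ran[of i] inj_on_eq_iff[OF inj, of i j] by (simp add: Q_def)
  qed (use P Q in auto)
  have QP: "Q * P = 1\<^sub>m n" using mat_mult_left_right_inverse[OF P Q PQ] .
  have "A = P * B * Q"
  proof (rule eq_matI)
    fix i j assume "i < dim_row (P * B * Q)" "j < dim_col (P * B * Q)"
    then have ij: "i < n" "j < n" using P Q by simp_all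
    then show "A $$ (i, j) = (P * B * Q) $$ (i, j)"
      using MQ[OF mult_carrier_mat[OF P B] ij] PM[OF B ij(1) ran[OF ij(2)]] eq[OF ij] by simp
  qed (use P Q A in auto)
  then show ?thesis using similar_matI[of A B P Q n] A B P Q PQ QP by auto
qed

text \<open>The case of an unchanged row. Placing k zero rows on top of Z leaves the new block a
  direct summand: after regrouping, the matrix is the direct sum of \<open>jordan_block k 0\<close>
  and the old extension.\<close>

lemma extension_prepend_block:
  fixes N Z B :: "'a::field mat"
  assumes N: "N \<in> carrier_mat p p" and Z: "Z \<in> carrier_mat p m"
    and sim: "similar_mat (four_block_mat N Z (0\<^sub>m m p) (0\<^sub>m m m)) B"
  shows "\<exists>Z' \<in> carrier_mat (k + p) m. similar_mat
    (four_block_mat (four_block_mat (jordan_block k 0) (0\<^sub>m k p) (0\<^sub>m p k) N) Z' (0\<^sub>m m (k + p)) (0\<^sub>m m m))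
    (four_block_mat (jordan_block k 0) (0\<^sub>m k (p + m)) (0\<^sub>m (p + m) k) B)"
proof
  let ?A = "four_block_mat N Z (0\<^sub>m m p) (0\<^sub>m m m)"
  let ?Z' = "mat (k + p) m (\<lambda>(i, j). if i < k then 0 else Z $$ (i - k, j))"
  show "?Z' \<in> carrier_mat (k + p) m" by simp
  have A: "?A \<in> carrier_mat (p + m) (p + m)" using N Z by simp
  have "four_block_mat (four_block_mat (jordan_block k 0) (0\<^sub>m k p) (0\<^sub>m p k) N) ?Z' (0\<^sub>m m (k + p)) (0\<^sub>m m m)
      = four_block_mat (jordan_block k 0) (0\<^sub>m k (p + m)) (0\<^sub>m (p + m) k) ?A"
    using N Z by (intro eq_matI) (auto simp: jordan_block_def)
  moreover have "similar_mat (four_block_mat (jordan_block k 0) (0\<^sub>m k (p + m)) (0\<^sub>m (p + m) k) ?A)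
      (four_block_mat (jordan_block k 0) (0\<^sub>m k (p + m)) (0\<^sub>m (p + m) k) B)"
    by (rule similar_mat_four_block_0_0[OF similar_mat_refl[OF jordan_block_carrier] sim jordan_block_carrier A])
  ultimately show "similar_mat
    (four_block_mat (four_block_mat (jordan_block k 0) (0\<^sub>m k p) (0\<^sub>m p k) N) ?Z' (0\<^sub>m m (k + p)) (0\<^sub>m m m))
    (four_block_mat (jordan_block k 0) (0\<^sub>m k (p + m)) (0\<^sub>m (p + m) k) B)" by simp
qed

text \<open>The case of a lengthened row. The new first column of Z' sends the new basis vector to
  the last basis vector of the block (row i with \<open>Suc i = k\<close>), which extends its Jordan
  chain by one. For k = 0 that column is zero and the new vector forms a block of size one.\<close>

lemma extension_enlarge_block:
  fixes N Z B :: "'a::field mat"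
  assumes N: "N \<in> carrier_mat p p" and Z: "Z \<in> carrier_mat p m"
    and sim: "similar_mat (four_block_mat N Z (0\<^sub>m m p) (0\<^sub>m m m)) B"
  shows "\<exists>Z' \<in> carrier_mat (k + p) (Suc m). similar_mat
    (four_block_mat (four_block_mat (jordan_block k 0) (0\<^sub>m k p) (0\<^sub>m p k) N) Z'
      (0\<^sub>m (Suc m) (k + p)) (0\<^sub>m (Suc m) (Suc m)))
    (four_block_mat (jordan_block (Suc k) 0) (0\<^sub>m (Suc k) (p + m)) (0\<^sub>m (p + m) (Suc k)) B)"
proof
  let ?A = "four_block_mat N Z (0\<^sub>m m p) (0\<^sub>m m m)"
  let ?Z' = "mat (k + p) (Suc m) (\<lambda>(i, j). if j = 0 then (if Suc i = k then 1 else 0)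
    else if i < k then 0 else Z $$ (i - k, j - 1))"
  let ?L = "four_block_mat (four_block_mat (jordan_block k 0) (0\<^sub>m k p) (0\<^sub>m p k) N) ?Z'
    (0\<^sub>m (Suc m) (k + p)) (0\<^sub>m (Suc m) (Suc m))"
  let ?R = "four_block_mat (jordan_block (Suc k) 0) (0\<^sub>m (Suc k) (p + m)) (0\<^sub>m (p + m) (Suc k)) ?A"
  (* Moves the first basis vector of the extension directly behind the enlarged block. *)
  define \<pi> where "\<pi> i = (if i < k then i else if i < k + p then Suc i else if i = k + p then k else i)" for i
  show "?Z' \<in> carrier_mat (k + p) (Suc m)" by simp
  have A: "?A \<in> carrier_mat (p + m) (p + m)" using N Z by simp
  have "similar_mat ?L ?R"
  proof (rule similar_mat_permute[where \<pi> = \<pi> and n = "k + p + Suc m"])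
    show "?L \<in> carrier_mat (k + p + Suc m) (k + p + Suc m)" using N by auto
    show "?R \<in> carrier_mat (k + p + Suc m) (k + p + Suc m)" using N Z by auto
    show "inj_on \<pi> {..<k + p + Suc m}"
      by (auto simp: inj_on_def \<pi>_def split: if_splits)
    show "\<pi> i < k + p + Suc m" if "i < k + p + Suc m" for i
      using that by (auto simp: \<pi>_def)
    show "?L $$ (i, j) = ?R $$ (\<pi> i, \<pi> j)" if ij: "i < k + p + Suc m" "j < k + p + Suc m" for i j
    proof -
      \<comment> \<open>The four ranges are the block, the part of N, the new basis vector and the
        old extension. Writing indices as offsets lets every entry be evaluated, range by
        range.\<close>
      have split: "l < k \<or> (\<exists>a < p. l = k + a) \<or> l = k + p \<or> (\<exists>a < m. l = Suc (k + p + a))"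
        if "l < k + p + Suc m" for l
        using that by presburger
      from split[OF ij(1)] split[OF ij(2)] show ?thesis
        using N Z by (elim disjE exE conjE) (simp_all add: \<pi>_def jordan_block_def)
    qed
  qed
  moreover have "similar_mat ?R
      (four_block_mat (jordan_block (Suc k) 0) (0\<^sub>m (Suc k) (p + m)) (0\<^sub>m (p + m) (Suc k)) B)"
    by (rule similar_mat_four_block_0_0[OF similar_mat_refl[OF jordan_block_carrier] sim jordan_block_carrier A])
  ultimately show "similar_mat ?L
      (four_block_mat (jordan_block (Suc k) 0) (0\<^sub>m (Suc k) (p + m)) (0\<^sub>m (p + m) (Suc k)) B)"
    by (rule similar_mat_trans)
qed

(* new_row lengthens an empty row, beyond the end of the first list. *)
inductive box_per_row :: "nat list \<Rightarrow> nat list \<Rightarrow> bool" where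
  Nil: "box_per_row [] []"
| new_row: "box_per_row [] \<mu> \<Longrightarrow> box_per_row [] (1 # \<mu>)"
| same_row: "box_per_row \<nu> \<mu> \<Longrightarrow> box_per_row (k # \<nu>) (k # \<mu>)"
| longer_row: "box_per_row \<nu> \<mu> \<Longrightarrow> box_per_row (k # \<nu>) (Suc k # \<mu>)"

lemma nilpotent_jordan_Nil: "nilpotent_jordan [] = (1\<^sub>m 0 :: 'a::field mat)"
  by (rule eq_matI) (auto simp: nilpotent_jordan_def jordan_matrix_def)

lemma nilpotent_jordan_Cons:
  "(nilpotent_jordan (k # \<nu>) :: 'a::field mat) = four_block_mat (jordan_block k 0)
    (0\<^sub>m k (sum_list \<nu>)) (0\<^sub>m (sum_list \<nu>) k) (nilpotent_jordan \<nu>)"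
  by (simp add: nilpotent_jordan_def jordan_matrix_Cons comp_def)

lemma nilpotent_jordan_carrier:
  "(nilpotent_jordan \<nu> :: 'a::field mat) \<in> carrier_mat (sum_list \<nu>) (sum_list \<nu>)"
  using jordan_matrix_carrier[of "map (\<lambda>k. (k, 0 :: 'a)) \<nu>"] by (simp add: nilpotent_jordan_def comp_def)

text \<open>The induction prepends rows, so Z is built from the bottom row upwards. The width m is
  the number of lengthened rows: it grows by one in \<open>new_row\<close> and
  \<open>longer_row\<close> and stays the same in \<open>same_row\<close>.\<close>

lemma extension_of_box_per_row:
  assumes "box_per_row \<nu> \<mu>"
  shows "\<exists>m. sum_list \<mu> = sum_list \<nu> + m \<and> (\<exists>Z \<in> carrier_mat (sum_list \<nu>) m.
    similar_mat (four_block_mat (nilpotent_jordan \<nu>) Z (0\<^sub>m m (sum_list \<nu>)) (0\<^sub>m m m))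
      (nilpotent_jordan \<mu> :: 'a::field mat))"
  using assms
proof induct
  case Nil
  have "four_block_mat (1\<^sub>m 0) (0\<^sub>m 0 0) (0\<^sub>m 0 0) (0\<^sub>m 0 0) = (1\<^sub>m 0 :: 'a mat)"
    by (rule eq_matI) auto
  then show ?case
    by (auto simp: nilpotent_jordan_Nil intro!: bexI[of _ "0\<^sub>m 0 0"] similar_mat_refl[OF one_carrier_mat])
next
  case (new_row \<mu>)
  then obtain m and Z :: "'a mat" where Z: "Z \<in> carrier_mat 0 m" and m: "sum_list \<mu> = m"
    and sim: "similar_mat (four_block_mat (nilpotent_jordan []) Z (0\<^sub>m m 0) (0\<^sub>m m m)) (nilpotent_jordan \<mu>)"
    by auto
  \<comment> \<open>Prepending a block of size 0 changes nothing, so a new row is the enlargement of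
    an empty block.\<close>
  have "four_block_mat (jordan_block 0 0) (0\<^sub>m 0 0) (0\<^sub>m 0 0) (nilpotent_jordan []) = (nilpotent_jordan [] :: 'a mat)"
    by (rule eq_matI) (auto simp: nilpotent_jordan_Nil jordan_block_def)
  then show ?case
    using extension_enlarge_block[OF _ Z sim, of 0] nilpotent_jordan_carrier[of "[]"] m
    by (simp add: nilpotent_jordan_Cons)
next
  case (same_row \<nu> \<mu> k)
  then obtain m and Z :: "'a mat" where Z: "Z \<in> carrier_mat (sum_list \<nu>) m" and m: "sum_list \<mu> = sum_list \<nu> + m"
    and sim: "similar_mat (four_block_mat (nilpotent_jordan \<nu>) Z (0\<^sub>m m (sum_list \<nu>)) (0\<^sub>m m m)) (nilpotent_jordan \<mu>)"
    by auto
  then show ?case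
    using extension_prepend_block[OF nilpotent_jordan_carrier Z sim, of k] m
    by (simp add: nilpotent_jordan_Cons)
next
  case (longer_row \<nu> \<mu> k)
  then obtain m and Z :: "'a mat" where Z: "Z \<in> carrier_mat (sum_list \<nu>) m" and m: "sum_list \<mu> = sum_list \<nu> + m"
    and sim: "similar_mat (four_block_mat (nilpotent_jordan \<nu>) Z (0\<^sub>m m (sum_list \<nu>)) (0\<^sub>m m m)) (nilpotent_jordan \<mu>)"
    by auto
  then show ?case
    using extension_enlarge_block[OF nilpotent_jordan_carrier Z sim, of k] m
    by (simp add: nilpotent_jordan_Cons)
qed

section \<open>Diagrams, conjugation and column heights\<close>

text \<open>Column j is row j of the conjugate, whose length is the number of parts larger than j.
  This translates diagrams into the counts that kernel dimensions provide.\<close>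

lemma diagram_iff_less_length_filter:
  assumes xs: "partition_of n xs"
  shows "(i, j) \<in> diagram xs \<longleftrightarrow> i < length (filter (\<lambda>x. j < x) xs)"
proof -
  have "(i, j) \<in> diagram xs \<longleftrightarrow> (j, i) \<in> diagram (conjugate_partition xs)"
    by (simp add: diagram_conjugate_partition[OF xs])
  also have "\<dots> \<longleftrightarrow> i < length (filter (\<lambda>x. j < x) xs)"
  proof (cases xs)
    case Nil
    then show ?thesis by (simp add: diagram_def conjugate_partition_def)
  next
    case (Cons k ks)
    \<comment> \<open>The conjugate list has only k entries; beyond them the count is 0, since the
      first part k is the largest.\<close>
    have "j < k" if "i < length (filter (\<lambda>x. j < x) xs)"
    proof -
      from that have "filter (\<lambda>x. j < x) xs \<noteq> []" by auto
      then obtain x where "x \<in> set xs" "j < x" by (auto simp: filter_empty_conv)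
      then show ?thesis using xs Cons by (auto simp: partition_of_def)
    qed
    moreover have "conjugate_partition xs = map (\<lambda>j. length (filter (\<lambda>x. j < x) xs)) [0..<k]"
      by (simp only: conjugate_partition_def Cons list.case length_filter_conv_card)
    ultimately show ?thesis
      by (auto simp: diagram_def cong: conj_cong)
  qed
  finally show ?thesis .
qed

lemma sum_list_eq_card_diagram: "sum_list xs = card (diagram xs)"
proof -
  have "diagram xs = Sigma {..<length xs} (\<lambda>i. {..<xs ! i})" by (auto simp: diagram_def)
  then show ?thesis by (simp add: card_SigmaI sum_list_sum_nth atLeast0LessThan)
qed

text \<open>Conjugation transposes diagrams, so distinct columns turn into distinct rows. It also
  preserves the number of boxes, hence the size condition follows from the sizes of \<mu> and
  \<nu>.\<close>

lemma horizontal_strip_conjugate_iff: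
  assumes \<nu>: "partition_of (n - m) \<nu>" and \<mu>: "partition_of n \<mu>" and "m \<le> n"
  shows "horizontal_strip m (conjugate_partition \<mu>) (conjugate_partition \<nu>) \<longleftrightarrow>
    diagram \<nu> \<subseteq> diagram \<mu> \<and> inj_on fst (diagram \<mu> - diagram \<nu>)"
proof -
  have "sum_list (conjugate_partition xs) = n'" if "partition_of n' xs" for n' xs
    using that by (simp add: sum_list_eq_card_diagram diagram_conjugate_partition card_inverse)
      (simp add: partition_of_def flip: sum_list_eq_card_diagram)
  then have "sum_list (conjugate_partition \<mu>) = sum_list (conjugate_partition \<nu>) + m"
    using assms by simp
  moreover have "inj_on snd ((diagram \<mu>)\<inverse> - (diagram \<nu>)\<inverse>) \<longleftrightarrow> inj_on fst (diagram \<mu> - diagram \<nu>)"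
  proof -
    have "(diagram \<mu>)\<inverse> - (diagram \<nu>)\<inverse> = prod.swap ` (diagram \<mu> - diagram \<nu>)" by force
    moreover have "snd \<circ> prod.swap = (fst :: nat \<times> nat \<Rightarrow> nat)" by auto
    ultimately show ?thesis
      using comp_inj_on_iff[of prod.swap "diagram \<mu> - diagram \<nu>" snd] by simp
  qed
  ultimately show ?thesis
    by (simp add: horizontal_strip_def diagram_conjugate_partition[OF \<nu>] diagram_conjugate_partition[OF \<mu>])
qed

text \<open>Induction on \<mu>, stripping the top row of both diagrams; \<open>tl\<close> of the
  empty list lets a missing row of \<nu> count as empty. Positivity of the parts makes \<nu> run out
  no later than \<mu>.\<close>

lemma box_per_row_of_diagram:
  assumes "0 \<notin> set \<nu>" "0 \<notin> set \<mu>" "diagram \<nu> \<subseteq> diagram \<mu>" "inj_on fst (diagram \<mu> - diagram \<nu>)"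
  shows "box_per_row \<nu> \<mu>"
  using assms
proof (induct \<mu> arbitrary: \<nu>)
  case Nil
  have "\<nu> = []"
  proof (rule ccontr)
    assume "\<nu> \<noteq> []"
    then have "(0, 0) \<in> diagram \<nu>" using Nil(1) by (cases \<nu>) (auto simp: diagram_def)
    with Nil(3) show False by (auto simp: diagram_def)
  qed
  then show ?case by (simp add: box_per_row.Nil)
next
  case (Cons k \<mu>)
  have tl: "(i, j) \<in> diagram (tl xs) \<longleftrightarrow> (Suc i, j) \<in> diagram xs" for i j and xs :: "nat list"
    by (cases xs) (auto simp: diagram_def)
  have "box_per_row (tl \<nu>) \<mu>"
  proof (rule Cons(1))
    show "0 \<notin> set (tl \<nu>)" using Cons(2) by (cases \<nu>) auto
    show "0 \<notin> set \<mu>" using Cons(3) by simp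
    show "diagram (tl \<nu>) \<subseteq> diagram \<mu>"
      using Cons(4) tl[of _ _ "k # \<mu>"] tl[of _ _ \<nu>] by fastforce
    show "inj_on fst (diagram \<mu> - diagram (tl \<nu>))"
    proof (rule inj_onI)
      fix x y assume "x \<in> diagram \<mu> - diagram (tl \<nu>)" "y \<in> diagram \<mu> - diagram (tl \<nu>)" "fst x = fst y"
      then show "x = y"
        using inj_onD[OF Cons(5), of "(Suc (fst x), snd x)" "(Suc (fst y), snd y)"]
          tl[of _ _ "k # \<mu>"] tl[of _ _ \<nu>] by (cases x; cases y) auto
    qed
  qed
  have two: False if "(0, j) \<notin> diagram \<nu>" "(0, j') \<notin> diagram \<nu>" "j < k" "j' < k" "j \<noteq> j'" for j j'
    using that inj_onD[OF Cons(5), of "(0, j)" "(0, j')"] by (auto simp: diagram_def)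
  have "k > 0" using Cons(3) by simp
  show ?case
  proof (cases \<nu>)
    case Nil
    \<comment> \<open>All k boxes of the row are new here; the first and the last must coincide, so
      k = 1.\<close>
    with two[of 0 "k - 1"] \<open>k > 0\<close> have "k = 1" by (cases "k - 1 = 0") (auto simp: diagram_def)
    with \<open>box_per_row (tl \<nu>) \<mu>\<close> Nil show ?thesis using box_per_row.new_row[of \<mu>] by simp
  next
    case (Cons y \<nu>')
    have "y \<le> k"
    proof (rule ccontr)
      assume "\<not> y \<le> k"
      then have "(0, k) \<in> diagram \<nu>" by (simp add: Cons diagram_def)
      with \<open>diagram \<nu> \<subseteq> diagram (k # \<mu>)\<close> have "(0, k) \<in> diagram (k # \<mu>)" by blast
      then show False by (simp add: diagram_def)
    qed
    moreover have "k \<le> Suc y"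
      \<comment> \<open>If k exceeded y + 1, the boxes in columns y and y + 1 would both be
        new.\<close>
      using two[of y "Suc y"] by (cases "k \<le> Suc y") (auto simp: diagram_def Cons)
    ultimately have "k = y \<or> k = Suc y" by linarith
    with \<open>box_per_row (tl \<nu>) \<mu>\<close> Cons show ?thesis
      by (auto intro: box_per_row.intros)
  qed
qed

text \<open>The counts are column heights. \<open>le\<close> compares equal columns and gives
  containment. \<open>ge\<close> compares column k + 1 of \<mu> with column k of \<nu>, so a box of
  \<mu> with another box to its right lies in \<nu>; only the last box of a row can be new.\<close>

lemma diagram_of_counts:
  assumes \<nu>: "partition_of n' \<nu>" and \<mu>: "partition_of n \<mu>"
    and le: "\<And>k. length (filter (\<lambda>x. k < x) \<nu>) \<le> length (filter (\<lambda>x. k < x) \<mu>)"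
    and ge: "\<And>k. length (filter (\<lambda>x. Suc k < x) \<mu>) \<le> length (filter (\<lambda>x. k < x) \<nu>)"
  shows "diagram \<nu> \<subseteq> diagram \<mu>" and "inj_on fst (diagram \<mu> - diagram \<nu>)"
proof -
  note iff = diagram_iff_less_length_filter
  show "diagram \<nu> \<subseteq> diagram \<mu>"
    using less_le_trans[OF _ le] by (auto simp: iff[OF \<nu>] iff[OF \<mu>])
  have shift: "(i, j) \<in> diagram \<nu>" if "(i, j') \<in> diagram \<mu>" "j < j'" for i j j'
  proof -
    have "(i, Suc j) \<in> diagram \<mu>" using that by (auto simp: diagram_def)
    then show ?thesis using ge[of j] by (simp add: iff[OF \<nu>] iff[OF \<mu>])
  qed
  show "inj_on fst (diagram \<mu> - diagram \<nu>)"
  proof (rule inj_onI, clarsimp)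
    fix i j j'
    assume "(i, j) \<in> diagram \<mu>" "(i, j) \<notin> diagram \<nu>" "(i, j') \<in> diagram \<mu>" "(i, j') \<notin> diagram \<nu>"
    then show "j = j'" using shift[of i j' j] shift[of i j j'] by (cases j j' rule: linorder_cases) auto
  qed
qed

section \<open>Kernel dimensions of nilpotent Jordan matrices and the equivalence\<close>

text \<open>With the next lemma this identifies the increment of the kernel dimension from the k-th
  to the next power as the number of parts larger than k.\<close>

lemma sum_list_min_Suc:
  "sum_list (map (min (Suc k)) xs) = sum_list (map (min k) xs) + length (filter (\<lambda>x. k < x) xs)"
  by (induct xs) (auto simp: min_def)

lemma kernel_dim_pow_of_similar_nilpotent_jordan:
  fixes A :: "'a::field mat"
  assumes "similar_mat A (nilpotent_jordan \<mu>)"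
  shows "kernel_dim (A ^\<^sub>m k) = sum_list (map (min k) \<mu>)"
proof -
  obtain d where "A \<in> carrier_mat d d" using similar_matD[OF assms] by blast
  \<comment> \<open>The kernel of A^k is the generalised eigenspace of order k at eigenvalue 0; its
    dimension is invariant under similarity, and a Jordan block of size p contributes min k
    p.\<close>
  then have "char_matrix A 0 = A" by (intro eq_matI) (auto simp: char_matrix_def)
  then have "kernel_dim (A ^\<^sub>m k) = dim_gen_eigenspace A 0 k" by (simp add: dim_gen_eigenspace_def)
  also have "\<dots> = dim_gen_eigenspace (nilpotent_jordan \<mu>) (0 :: 'a) k"
    by (simp add: dim_gen_eigenspace_similar[OF assms])
  also have "\<dots> = sum_list (map (min k) \<mu>)"
    by (simp add: nilpotent_jordan_def dim_gen_eigenspace_jordan_matrix filter_map comp_def)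
  finally show ?thesis .
qed

theorem theorem3p11:
  fixes n m :: nat and \<nu> \<mu> :: "nat list"
  assumes "n \<ge> 2" and "1 \<le> m" and "m \<le> n"
    and "partition_of (n - m) \<nu>" and "partition_of n \<mu>"
  shows "eligible TYPE('a::field) n \<nu> m \<mu> \<longleftrightarrow>
    horizontal_strip m (conjugate_partition \<mu>) (conjugate_partition \<nu>)"
proof -
  note \<nu> = assms(4) and \<mu> = assms(5)
  have sums: "sum_list \<nu> = n - m" "sum_list \<mu> = n" using \<nu> \<mu> by (auto simp: partition_of_def)
  have J: "(nilpotent_jordan \<nu> :: 'a mat) \<in> carrier_mat (n - m) (n - m)"
    using nilpotent_jordan_carrier[of \<nu>] by (simp add: sums)
  show ?thesis unfolding horizontal_strip_conjugate_iff[OF \<nu> \<mu> \<open>m \<le> n\<close>]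
  proof (intro iffI conjI)
    assume "eligible TYPE('a) n \<nu> m \<mu>"
    then obtain Z :: "'a mat" where Z: "Z \<in> carrier_mat (n - m) m" and
      sim: "similar_mat (four_block_mat (nilpotent_jordan \<nu>) Z (0\<^sub>m m (n - m)) (0\<^sub>m m m)) (nilpotent_jordan \<mu>)"
      by (auto simp: eligible_def conj_class_def)
    note dims = kernel_dim_pow_of_similar_nilpotent_jordan[OF similar_mat_refl[OF J]]
      kernel_dim_pow_of_similar_nilpotent_jordan[OF sim] sum_list_min_Suc
    \<comment> \<open>Once the dimensions are expanded, the common sums cancel and only the counts
      of parts remain.\<close>
    have "length (filter (\<lambda>x. k < x) \<nu>) \<le> length (filter (\<lambda>x. k < x) \<mu>)"
      "length (filter (\<lambda>x. Suc k < x) \<mu>) \<le> length (filter (\<lambda>x. k < x) \<nu>)" for k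
      using kernel_dim_extension[OF J Z, of k] unfolding dims by simp_all
    from diagram_of_counts[OF \<nu> \<mu> this]
    show "diagram \<nu> \<subseteq> diagram \<mu>" and "inj_on fst (diagram \<mu> - diagram \<nu>)" by auto
  next
    assume "diagram \<nu> \<subseteq> diagram \<mu> \<and> inj_on fst (diagram \<mu> - diagram \<nu>)"
    then have "box_per_row \<nu> \<mu>"
      using \<nu> \<mu> by (intro box_per_row_of_diagram) (auto simp: partition_of_def)
    from extension_of_box_per_row[OF this, where 'a = 'a] obtain m' and Z :: "'a mat" where
      m': "sum_list \<mu> = sum_list \<nu> + m'" and Z: "Z \<in> carrier_mat (sum_list \<nu>) m'" and
      sim: "similar_mat (four_block_mat (nilpotent_jordan \<nu>) Z (0\<^sub>m m' (sum_list \<nu>)) (0\<^sub>m m' m')) (nilpotent_jordan \<mu>)"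
      by blast
    \<comment> \<open>The width produced by the construction is |\<mu>| - |\<nu>|; m \<le> n makes
      the natural subtraction n - m exact.\<close>
    have "m' = m" using m' sums \<open>m \<le> n\<close> by simp
    then show "eligible TYPE('a) n \<nu> m \<mu>"
      using Z sim by (auto simp: eligible_def conj_class_def sums)
  qed
qed

end
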